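(* Let $L_\tau=(L,\tau)$ be a topoframe. Then $L_\tau$ is a $P$-topoframe if and only if the ring $\mathcal{R}L_\tau$ is $\aleph_0$-selfinjective.
   Context: A frame is a complete lattice $L$ (top $\top$, bottom $\bot$) with $a\wedge\bigvee S=\bigvee\{a\wedge s: s\in S\}$ for all $a\in L$, $S\subseteq L$. A frame homomorphism preserves finite meets (including $\top$) and arbitrary joins (including $\bot$). A topoframe $L_\tau$ is a pair $(L,\tau)$ where $L$ is a frame and $\tau$ is a subframe of $L$ all of whose elements are complemented in $L$. A real-continuous function on $L_\tau$ is a frame homomorphism $f:\mathcal{P}(\mathbb{R})\to L$ (where $\mathcal P(\mathbb R)$ is the power set of $\mathbb R$) such that $f(\{x\in\mathbb R: p<x<q\})\in\tau$ for all $p,q\in\mathbb{Q}$. $\mathcal{R}L_\tau$ is the set of all these; it is a commutative (reduced) ring with identity under $(f\diamond g)(X)=\bigvee\{f(Y)\wedge g(Z): Y\diamond Z\subseteq X\}$ for $\diamond\in\{+,\cdot\}$, where $Y\diamond Z=\{y\diamond z: y\in Y, z\in Z\}$, with $(-f)(X)=f(-X)$, and with the constants $\mathbf{r}$ ($r\in\mathbb R$) given by $\mathbf r(X)=\top$ if $r\in X$ and $\bot$ otherwise; $\mathbf 0$ and $\mathbf 1$ are the zero and identity. For $f\in\mathcal{R}L_\tau$, $z(f)=f(\{0\})$. $L_\tau$ is a $P$-topoframe if $z(f)\in\tau$ for all $f\in\mathcal{R}L_\tau$. A commutative ring $A$ with identity is $\aleph_0$-selfinjective if every $A$-homomorphism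 from a countably generated ideal of $A$ to $A$ can be extended to an $A$-homomorphism from $A$ to $A$. *)

theory Defs
  imports Complex_Main "HOL-Library.Countable_Set" "HOL-Algebra.Ideal"
begin

hide_const (open) Order.top Order.bottom Lattice.sup Lattice.inf

text \<open>
  The library class \<open>complete_distrib_lattice\<close> demands full complete distributivity, which
  is strictly stronger than the frame law.
\<close>

class frame = complete_lattice +
  assumes inf_Sup_frame: "inf a (Sup S) = Sup {inf a s | s. s \<in> S}"

instance set :: (type) frame
  by standard auto

text \<open>Preservation of \<open>bot\<close> is the case \<open>S = {}\<close>.\<close>

definition frame_hom :: "('a::frame \<Rightarrow> 'b::frame) \<Rightarrow> bool" where
  "frame_hom f \<longleftrightarrow> f top = top \<and> (\<forall>x y. f (inf x y) = inf (f x) (f y)) \<and>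
     (\<forall>S. f (Sup S) = Sup (f ` S))"

definition subframe :: "'a::frame set \<Rightarrow> bool" where
  "subframe T \<longleftrightarrow> top \<in> T \<and> (\<forall>x\<in>T. \<forall>y\<in>T. inf x y \<in> T) \<and> (\<forall>S\<subseteq>T. Sup S \<in> T)"

definition complemented :: "'a::frame \<Rightarrow> bool" where
  "complemented a \<longleftrightarrow> (\<exists>b. inf a b = bot \<and> sup a b = top)"

text \<open>The frame \<open>L\<close> is the whole type \<open>'a\<close>; complements are taken in \<open>L\<close>, not in \<open>\<tau>\<close>.\<close>

definition topoframe :: "'a::frame set \<Rightarrow> bool" where
  "topoframe \<tau> \<longleftrightarrow> subframe \<tau> \<and> (\<forall>a\<in>\<tau>. complemented a)"

definition real_continuous :: "'a::frame set \<Rightarrow> (real set \<Rightarrow> 'a) \<Rightarrow> bool" where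
  "real_continuous \<tau> f \<longleftrightarrow> frame_hom f \<and>
     (\<forall>p q :: rat. f {x. of_rat p < x \<and> x < of_rat q} \<in> \<tau>)"

definition rc_op ::
  "(real \<Rightarrow> real \<Rightarrow> real) \<Rightarrow> (real set \<Rightarrow> 'a::frame) \<Rightarrow> (real set \<Rightarrow> 'a) \<Rightarrow> real set \<Rightarrow> 'a" where
  "rc_op d f g X = Sup {inf (f Y) (g Z) | Y Z. {d y z | y z. y \<in> Y \<and> z \<in> Z} \<subseteq> X}"

definition rc_const :: "real \<Rightarrow> real set \<Rightarrow> 'a::frame" where
  "rc_const r X = (if r \<in> X then top else bot)"

definition rc_ring :: "'a::frame set \<Rightarrow> (real set \<Rightarrow> 'a) ring" where
  "rc_ring \<tau> = \<lparr>carrier = {f. real_continuous \<tau> f}, mult = rc_op (*), one = rc_const 1,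
     zero = rc_const 0, add = rc_op (+)\<rparr>"

definition zero_elem :: "(real set \<Rightarrow> 'a::frame) \<Rightarrow> 'a" where
  "zero_elem f = f {0}"

definition P_topoframe :: "'a::frame set \<Rightarrow> bool" where
  "P_topoframe \<tau> \<longleftrightarrow> topoframe \<tau> \<and> (\<forall>f. real_continuous \<tau> f \<longrightarrow> zero_elem f \<in> \<tau>)"

text \<open>
  \<open>R\<close>-module homomorphisms from \<open>I\<close> (an ideal of \<open>R\<close>, possibly \<open>R\<close> itself) to \<open>R\<close>.
  Only the values on \<open>I\<close> matter.
\<close>

definition ideal_hom :: "('a, 'm) ring_scheme \<Rightarrow> 'a set \<Rightarrow> ('a \<Rightarrow> 'a) set" where
  "ideal_hom R I = {h. h \<in> I \<rightarrow> carrier R \<and>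
     (\<forall>x\<in>I. \<forall>y\<in>I. h (x \<oplus>\<^bsub>R\<^esub> y) = h x \<oplus>\<^bsub>R\<^esub> h y) \<and>
     (\<forall>a\<in>carrier R. \<forall>x\<in>I. h (a \<otimes>\<^bsub>R\<^esub> x) = a \<otimes>\<^bsub>R\<^esub> h x)}"

definition countably_generated_ideal :: "('a, 'm) ring_scheme \<Rightarrow> 'a set \<Rightarrow> bool" where
  "countably_generated_ideal R I \<longleftrightarrow> (\<exists>S. countable S \<and> S \<subseteq> carrier R \<and> I = Idl\<^bsub>R\<^esub> S)"

definition aleph0_selfinjective :: "('a, 'm) ring_scheme \<Rightarrow> bool" where
  "aleph0_selfinjective R \<longleftrightarrow> cring R \<and>
     (\<forall>I. countably_generated_ideal R I \<longrightarrow>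
       (\<forall>h\<in>ideal_hom R I. \<exists>k\<in>ideal_hom R (carrier R). \<forall>x\<in>I. k x = h x))"


lemma inf_SUP_frame: "inf (a::'a::frame) (SUP i\<in>A. f i) = (SUP i\<in>A. inf a (f i))"
  unfolding inf_Sup_frame by (rule arg_cong[where f=Sup]) auto

lemma SUP_inf_frame: "inf (SUP i\<in>A. f i) (a::'a::frame) = (SUP i\<in>A. inf (f i) a)"
  using inf_SUP_frame[of a f A] by (simp add: inf.commute)

lemma frame_hom_point:
  assumes "frame_hom (f :: real set \<Rightarrow> 'a::frame)"
  shows "f X = (SUP x\<in>X. f {x})"
proof -
  have "f (\<Union>((\<lambda>x. {x}) ` X)) = Sup (f ` (\<lambda>x. {x}) ` X)"
    using assms unfolding frame_hom_def by blast
  then show ?thesis by (simp add: image_image)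
qed

lemma frame_hom_bot: "frame_hom f \<Longrightarrow> f bot = bot"
  unfolding frame_hom_def by (metis Sup_empty image_empty)

lemma frame_hom_disj:
  assumes "frame_hom (f :: real set \<Rightarrow> 'a::frame)" "x \<noteq> y"
  shows "inf (f {x}) (f {y}) = bot"
proof -
  have "inf (f {x}) (f {y}) = f (inf {x} {y})" using assms unfolding frame_hom_def by metis
  also have "inf {x} {y} = bot" using assms(2) by auto
  finally show ?thesis using frame_hom_bot[OF assms(1)] by simp
qed

lemma frame_hom_mono:
  assumes "frame_hom (f :: real set \<Rightarrow> 'a::frame)" "X \<subseteq> Y" shows "f X \<le> f Y"
  using assms unfolding frame_hom_def by (metis inf.absorb_iff1)

lemma rc_op_point:
  assumes f: "frame_hom f" and g: "frame_hom g"
  shows "rc_op d f g X = (SUP w\<in>{w. d (fst w) (snd w) \<in> X}. inf (f {fst w}) (g {snd w}))"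
    (is "_ = ?R")
proof (rule antisym)
  show "rc_op d f g X \<le> ?R"
    unfolding rc_op_def
  proof (rule Sup_least)
    fix u assume "u \<in> {inf (f Y) (g Z) |Y Z. {d y z |y z. y \<in> Y \<and> z \<in> Z} \<subseteq> X}"
    then obtain Y Z where u: "u = inf (f Y) (g Z)" and s: "\<And>y z. y \<in> Y \<Longrightarrow> z \<in> Z \<Longrightarrow> d y z \<in> X"
      by blast
    have "u = (SUP y\<in>Y. SUP z\<in>Z. inf (f {y}) (g {z}))"
      unfolding u frame_hom_point[OF f, of Y] frame_hom_point[OF g, of Z]
      by (simp add: inf_SUP_frame SUP_inf_frame, rule SUP_commute)
    also have "\<dots> \<le> ?R"
    proof (intro SUP_least)
      fix y z assume "y \<in> Y" "z \<in> Z"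
      then show "inf (f {y}) (g {z}) \<le> ?R"
        using s by (intro SUP_upper2[of "(y,z)"]) auto
    qed
    finally show "u \<le> ?R" .
  qed
  show "?R \<le> rc_op d f g X"
    unfolding rc_op_def
    by (intro SUP_least Sup_upper) blast
qed

lemma partition_frame_hom:
  fixes a :: "'i \<Rightarrow> 'a::frame" and \<phi> :: "'i \<Rightarrow> real"
  assumes top: "(SUP i. a i) = top" and disj: "\<And>i j. i \<noteq> j \<Longrightarrow> inf (a i) (a j) = bot"
  shows "frame_hom (\<lambda>X. SUP i\<in>{i. \<phi> i \<in> X}. a i)"
  unfolding frame_hom_def
proof (intro conjI allI)
  show "(SUP i\<in>{i. \<phi> i \<in> top}. a i) = top" using top by simp
next
  fix X Y
  show "(SUP i\<in>{i. \<phi> i \<in> inf X Y}. a i) =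
    inf (SUP i\<in>{i. \<phi> i \<in> X}. a i) (SUP i\<in>{i. \<phi> i \<in> Y}. a i)" (is "?l = ?r")
  proof (rule antisym)
    show "?l \<le> ?r" by (intro inf_greatest SUP_subset_mono) auto
    have "inf (a i) (a j) \<le> ?l" if "\<phi> i \<in> X" "\<phi> j \<in> Y" for i j
    proof (cases "i = j")
      case True then show ?thesis using that by (auto intro: SUP_upper)
    next
      case False then show ?thesis using disj by simp
    qed
    then show "?r \<le> ?l" by (simp add: inf_SUP_frame SUP_inf_frame SUP_le_iff)
  qed
next
  fix S
  show "(SUP i\<in>{i. \<phi> i \<in> Sup S}. a i) = Sup ((\<lambda>X. SUP i\<in>{i. \<phi> i \<in> X}. a i) ` S)"
    (is "?l = ?r")
  proof (rule antisym)
    show "?l \<le> ?r" by (auto intro!: SUP_least intro: SUP_upper2 SUP_upper)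
    show "?r \<le> ?l" by (auto intro!: SUP_least intro: SUP_upper)
  qed
qed

lemma frame_hom_rc_op:
  assumes f: "frame_hom f" and g: "frame_hom g"
  shows "frame_hom (rc_op d f g)"
proof -
  have t: "(SUP x. h {x}) = top" if "frame_hom h" for h :: "real set \<Rightarrow> 'a"
    using frame_hom_point[OF that, of UNIV] that unfolding frame_hom_def by simp
  have "frame_hom (\<lambda>X. SUP w\<in>{w. d (fst w) (snd w) \<in> X}. inf (f {fst w}) (g {snd w}))"
  proof (rule partition_frame_hom)
    have "top = inf (SUP x. f {x}) (SUP y. g {y})" using t[OF f] t[OF g] by simp
    also have "\<dots> \<le> (SUP w. inf (f {fst w}) (g {snd w}))"
    proof (simp only: inf_SUP_frame SUP_inf_frame, intro SUP_least)
      fix x y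
      show "inf (f {y}) (g {x}) \<le> (SUP w. inf (f {fst w}) (g {snd w}))"
        by (rule SUP_upper2[of "(y, x)"]) auto
    qed
    finally show "(SUP w. inf (f {fst w}) (g {snd w})) = top" by (simp add: top_unique)
  next
    fix i j :: "real \<times> real" assume "i \<noteq> j"
    then have "inf (f {fst i}) (f {fst j}) = bot \<or> inf (g {snd i}) (g {snd j}) = bot"
      using frame_hom_disj[OF f] frame_hom_disj[OF g] by (metis prod_eqI)
    moreover have "inf (inf (f {fst i}) (g {snd i})) (inf (f {fst j}) (g {snd j})) =
      inf (inf (f {fst i}) (f {fst j})) (inf (g {snd i}) (g {snd j}))"
      by (simp add: inf_assoc inf_left_commute)
    ultimately show "inf (inf (f {fst i}) (g {snd i})) (inf (f {fst j}) (g {snd j})) = bot" by auto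
  qed
  moreover have "rc_op d f g = (\<lambda>X. SUP w\<in>{w. d (fst w) (snd w) \<in> X}. inf (f {fst w}) (g {snd w}))"
    using rc_op_point[OF f g] by blast
  ultimately show ?thesis by simp
qed

lemma frame_hom_eqI:
  assumes f: "frame_hom (f :: real set \<Rightarrow> 'a::frame)" and g: "frame_hom g"
    and le: "\<And>x. f {x} \<le> g {x}"
  shows "f = g"
proof (rule ext)
  have le': "f X \<le> g X" for X
    unfolding frame_hom_point[OF f, of X] frame_hom_point[OF g, of X] by (rule SUP_mono') (rule le)
  fix X
  have "sup (f X) (f (-X)) = Sup (f ` {X, -X})" by simp
  also have "\<dots> = f (Sup {X, -X})" using f unfolding frame_hom_def by metis
  also have "Sup {X, -X} = top" by auto
  also have "f top = top" using f unfolding frame_hom_def by blast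
  finally have t: "sup (f X) (f (- X)) = top" .
  have "inf (g X) (f (- X)) \<le> inf (g X) (g (- X))" using le' by (meson inf_mono order_refl)
  also have "inf (g X) (g (- X)) = g (inf X (- X))" using g unfolding frame_hom_def by metis
  also have "\<dots> = bot" using frame_hom_bot[OF g] by simp
  finally have "inf (g X) (f (- X)) = bot" by (simp add: bot_unique)
  moreover have "inf (g X) (sup (f X) (f (- X))) = sup (inf (g X) (f X)) (inf (g X) (f (- X)))"
    using inf_SUP_frame[of "g X" "\<lambda>x. x" "{f X, f (-X)}"] by simp
  ultimately have "g X = inf (g X) (f X)" using t by simp
  then have "g X \<le> f X" by (simp add: inf.orderI)
  with le' show "f X = g X" by (simp add: antisym)
qed

lemma rational_interval:
  assumes "open (A :: real set)" "x \<in> A"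
  obtains p q :: rat where "of_rat p < x" "x < of_rat q" "{x. of_rat p < x \<and> x < of_rat q} \<subseteq> A"
proof -
  obtain e where e: "e > 0" "\<And>y. dist y x < e \<Longrightarrow> y \<in> A" using assms unfolding open_dist by blast
  obtain p where p: "x - e < of_rat p" "of_rat p < x" using of_rat_dense[of "x - e" x] e by auto
  obtain q where q: "x < of_rat q" "of_rat q < x + e" using of_rat_dense[of x "x + e"] e by auto
  have "y \<in> A" if "of_rat p < y" "y < of_rat q" for y
    by (rule e(2)) (use p q that in \<open>simp add: dist_real_def abs_less_iff\<close>)
  then show ?thesis using that[OF p(2) q(1)] by blast
qed

lemma real_continuous_rc_op:
  assumes T: "subframe \<tau>" and f: "real_continuous \<tau> f" and g: "real_continuous \<tau> g"
    and d: "continuous_on UNIV (\<lambda>w. d (fst w) (snd w))"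
  shows "real_continuous \<tau> (rc_op d f g)"
proof -
  let ?I = "\<lambda>p q :: rat. {x::real. of_rat p < x \<and> x < of_rat q}"
  have fh: "frame_hom f" and gh: "frame_hom g" using f g by (auto simp: real_continuous_def)
  have "rc_op d f g (?I p q) \<in> \<tau>" for p q
  proof -
    let ?W = "{(p1,q1,p2,q2). {d y z | y z. y \<in> ?I p1 q1 \<and> z \<in> ?I p2 q2} \<subseteq> ?I p q}"
    let ?S = "(\<lambda>(p1,q1,p2,q2). inf (f (?I p1 q1)) (g (?I p2 q2))) ` ?W"
    have "rc_op d f g (?I p q) = Sup ?S"
    proof (rule antisym)
      show "Sup ?S \<le> rc_op d f g (?I p q)"
      proof (rule SUP_least)
        fix t assume "t \<in> ?W"
        moreover obtain p1 q1 p2 q2 where "t = (p1,q1,p2,q2)" by (rule prod_cases4)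
        ultimately show "(case t of (p1,q1,p2,q2) \<Rightarrow> inf (f (?I p1 q1)) (g (?I p2 q2)))
            \<le> rc_op d f g (?I p q)"
          unfolding rc_op_def by (simp only: split_conv mem_Collect_eq, intro Sup_upper) blast
      qed
      show "rc_op d f g (?I p q) \<le> Sup ?S"
        unfolding rc_op_point[OF fh gh]
      proof (rule SUP_least)
        fix w assume w: "w \<in> {w. d (fst w) (snd w) \<in> ?I p q}"
        have "open {real_of_rat p<..<of_rat q}" by simp
        then have "open ((\<lambda>w. d (fst w) (snd w)) -` {real_of_rat p<..<of_rat q})"
          using d by (rule open_vimage)
        moreover have "w \<in> (\<lambda>w. d (fst w) (snd w)) -` {real_of_rat p<..<of_rat q}"
          using w by auto
        ultimately obtain A B where AB: "open A" "open B" "w \<in> A \<times> B"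
          "A \<times> B \<subseteq> (\<lambda>w. d (fst w) (snd w)) -` {real_of_rat p<..<of_rat q}"
          by (rule open_prod_elim)
        obtain p1 q1 where 1: "of_rat p1 < fst w" "fst w < of_rat q1" "?I p1 q1 \<subseteq> A"
          using rational_interval[OF AB(1), of "fst w"] AB(3) unfolding mem_Times_iff by blast
        obtain p2 q2 where 2: "of_rat p2 < snd w" "snd w < of_rat q2" "?I p2 q2 \<subseteq> B"
          using rational_interval[OF AB(2), of "snd w"] AB(3) unfolding mem_Times_iff by blast
        have AxB: "(y,z) \<in> A \<times> B" if "y \<in> ?I p1 q1" "z \<in> ?I p2 q2" for y z
          using that 1(3) 2(3) by blast
        then have "d y z \<in> ?I p q" if "y \<in> ?I p1 q1" "z \<in> ?I p2 q2" for y z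
        proof -
          have "(y, z) \<in> (\<lambda>w. d (fst w) (snd w)) -` {real_of_rat p<..<of_rat q}"
            using AB(4) AxB[OF that] by blast
          then show ?thesis by simp
        qed
        then have "(p1,q1,p2,q2) \<in> ?W" unfolding mem_Collect_eq split_conv by blast
        then have "inf (f (?I p1 q1)) (g (?I p2 q2)) \<le> Sup ?S"
          by (rule Sup_upper[OF image_eqI[rotated]]) (simp only: split_conv)
        moreover have "inf (f {fst w}) (g {snd w}) \<le> inf (f (?I p1 q1)) (g (?I p2 q2))"
          using 1 2 by (intro inf_mono frame_hom_mono[OF fh] frame_hom_mono[OF gh]) simp_all
        ultimately show "inf (f {fst w}) (g {snd w}) \<le> Sup ?S" by (rule order_trans[rotated])
      qed
    qed
    moreover have "?S \<subseteq> \<tau>"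
    proof -
      have "f (?I p1 q1) \<in> \<tau>" "g (?I p1 q1) \<in> \<tau>" for p1 q1
        using f g unfolding real_continuous_def by blast+
      moreover have "inf x y \<in> \<tau>" if "x \<in> \<tau>" "y \<in> \<tau>" for x y
        using T that unfolding subframe_def by blast
      ultimately show ?thesis by auto
    qed
    moreover have "Sup S \<in> \<tau>" if "S \<subseteq> \<tau>" for S
      using T that unfolding subframe_def by blast
    ultimately show ?thesis by simp
  qed
  then show ?thesis using frame_hom_rc_op[OF fh gh] by (simp add: real_continuous_def)
qed

lemma real_continuous_const:
  assumes "subframe \<tau>" shows "real_continuous \<tau> (rc_const r)"
proof -
  have "bot \<in> \<tau>" using assms unfolding subframe_def by (metis Sup_empty empty_subsetI)
  moreover have "frame_hom (rc_const r :: real set \<Rightarrow> 'a)"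
    unfolding frame_hom_def
  proof (intro conjI allI)
    fix S :: "real set set"
    show "(rc_const r (Sup S) :: 'a) = Sup (rc_const r ` S)"
    proof (cases "r \<in> Sup S")
      case True
      then have "top \<in> (rc_const r ` S :: 'a set)" by (force simp: rc_const_def)
      then have "top \<le> Sup (rc_const r ` S :: 'a set)" by (rule Sup_upper)
      then have "Sup (rc_const r ` S :: 'a set) = top" by (rule top_le)
      then show ?thesis using True by (simp only: rc_const_def if_True)
    next
      case False
      then have "Sup (rc_const r ` S) \<le> (bot::'a)" by (intro SUP_least) (auto simp: rc_const_def)
      then show ?thesis using False by (simp add: rc_const_def bot_unique)
    qed
  qed (auto simp: rc_const_def)
  ultimately show ?thesis using assms by (auto simp: real_continuous_def rc_const_def subframe_def)
qed

lemma rc_op_eqI: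
  assumes f: "frame_hom f" and g: "frame_hom g" and h: "frame_hom h"
    and le: "\<And>x y. inf (f {x}) (g {y}) \<le> h {d x y}"
  shows "rc_op d f g = h"
proof (rule frame_hom_eqI[OF frame_hom_rc_op[OF f g] h])
  fix x show "rc_op d f g {x} \<le> h {x}"
    unfolding rc_op_point[OF f g] using le by (auto intro!: SUP_least)
qed

lemma rc_op_upper:
  assumes "u \<le> f {x}" "u \<le> g {y}" "d x y = c"
  shows "u \<le> rc_op d f g {c}"
proof -
  have "inf (f {x}) (g {y}) \<le> rc_op d f g {c}"
    unfolding rc_op_def using assms(3) by (intro Sup_upper) blast
  then show ?thesis using assms by (meson inf_greatest order_trans)
qed

lemma rc_op_inf_le:
  assumes f: "frame_hom f" and g: "frame_hom g"
    and le: "\<And>x y. d x y = c \<Longrightarrow> inf (inf (f {x}) (g {y})) u \<le> v"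
  shows "inf (rc_op d f g {c}) u \<le> v"
  unfolding rc_op_point[OF f g] SUP_inf_frame using le by (auto intro!: SUP_least)

lemma rc_op_commute:
  assumes f: "frame_hom f" and g: "frame_hom g" and d: "\<And>x y. d x y = d y x"
  shows "rc_op d f g = rc_op d g f"
  by (rule rc_op_eqI[OF f g frame_hom_rc_op[OF g f]])
    (rule rc_op_upper, rule inf.cobounded2, rule inf.cobounded1, rule d)

lemma rc_op_assoc:
  assumes f: "frame_hom f" and g: "frame_hom g" and h: "frame_hom h"
    and d: "\<And>x y z. d (d x y) z = d x (d y z)"
  shows "rc_op d (rc_op d f g) h = rc_op d f (rc_op d g h)"
proof (rule rc_op_eqI)
  fix x y
  show "inf (rc_op d f g {x}) (h {y}) \<le> rc_op d f (rc_op d g h) {d x y}"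
    by (rule rc_op_inf_le[OF f g])
      (rule rc_op_upper, rule le_infI1, rule inf.cobounded1, rule rc_op_upper, rule le_infI1,
        rule inf.cobounded2, rule inf.cobounded2, rule refl, use d in auto)
qed (intro frame_hom_rc_op f g h)+

lemma rc_op_distrib:
  assumes f: "frame_hom f" and g: "frame_hom g" and h: "frame_hom h"
  shows "rc_op (*) (rc_op (+) f g) h = rc_op (+) (rc_op (*) f h) (rc_op (*) g h)"
proof (rule rc_op_eqI)
  fix x y
  show "inf (rc_op (+) f g {x}) (h {y}) \<le> rc_op (+) (rc_op (*) f h) (rc_op (*) g h) {x * y}"
  proof (rule rc_op_inf_le[OF f g])
    fix a b assume ab: "a + b = x"
    let ?u = "inf (inf (f {a}) (g {b})) (h {y})"
    have "?u \<le> rc_op (*) f h {a * y}" by (rule rc_op_upper[of _ _ a _ y]) (auto intro: le_infI1)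
    moreover have "?u \<le> rc_op (*) g h {b * y}" by (rule rc_op_upper[of _ _ b _ y]) (auto intro: le_infI1)
    ultimately show "?u \<le> rc_op (+) (rc_op (*) f h) (rc_op (*) g h) {x * y}"
      by (rule rc_op_upper) (simp add: ab[symmetric] distrib_right)
  qed
qed (intro frame_hom_rc_op f g h)+

lemma real_continuous_uminus:
  assumes "real_continuous \<tau> f"
  shows "real_continuous \<tau> (\<lambda>X. f (uminus ` X))"
proof -
  have f: "frame_hom f" using assms by (simp add: real_continuous_def)
  have "frame_hom (\<lambda>X. f (uminus ` X))"
    unfolding frame_hom_def
  proof (intro conjI allI)
    show "f (uminus ` top) = top" using f by (simp add: frame_hom_def surj_uminus)
  next
    fix X Y :: "real set"
    have "uminus ` (inf X Y) = inf (uminus ` X) (uminus ` Y)" by auto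
    then show "f (uminus ` (inf X Y)) = inf (f (uminus ` X)) (f (uminus ` Y))"
      using f by (simp add: frame_hom_def)
  next
    fix S :: "real set set"
    have "uminus ` (Sup S) = Sup ((\<lambda>X. uminus ` X) ` S)" by auto
    then have "f (uminus ` (Sup S)) = Sup (f ` (\<lambda>X. uminus ` X) ` S)"
      using f unfolding frame_hom_def by metis
    then show "f (uminus ` (Sup S)) = Sup ((\<lambda>X. f (uminus ` X)) ` S)"
      by (simp only: image_image)
  qed
  moreover have "uminus ` {x::real. of_rat p < x \<and> x < of_rat q} =
      {x. of_rat (- q) < x \<and> x < of_rat (- p)}" for p q
  proof (intro Set.set_eqI iffI)
    fix x :: real assume "x \<in> {x. of_rat (- q) < x \<and> x < of_rat (- p)}"
    then show "x \<in> uminus ` {x::real. of_rat p < x \<and> x < of_rat q}"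
      by (intro image_eqI[of _ _ "- x"]) (auto simp: of_rat_minus)
  qed (auto simp: of_rat_minus)
  ultimately show ?thesis using assms by (simp add: real_continuous_def)
qed

lemma rc_op_uminus:
  assumes "real_continuous \<tau> f" "subframe \<tau>"
  shows "rc_op (+) (\<lambda>X. f (uminus ` X)) f = rc_const 0"
proof (rule rc_op_eqI)
  show f: "frame_hom f" "frame_hom (\<lambda>X. f (uminus ` X))"
    using assms(1) real_continuous_uminus[OF assms(1)] by (auto simp: real_continuous_def)
  show "frame_hom (rc_const 0 :: real set \<Rightarrow> 'a)"
    using real_continuous_const[OF assms(2)] by (simp add: real_continuous_def)
  show "inf (f (uminus ` {x})) (f {y}) \<le> rc_const 0 {x + y}" for x y
    using frame_hom_disj[OF f(1), of "- x" y] by (cases "y = - x") (auto simp: rc_const_def)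
qed

lemma rc_op_unit:
  assumes "frame_hom f" "frame_hom (rc_const r :: real set \<Rightarrow> 'a::frame)" "\<And>x. d r x = x"
  shows "rc_op d (rc_const r) f = (f :: real set \<Rightarrow> 'a)"
  by (rule rc_op_eqI[OF assms(2,1,1)]) (auto simp: rc_const_def assms(3))

lemma cring_rc_ring:
  assumes "topoframe \<tau>"
  shows "cring (rc_ring \<tau>)"
proof -
  have T: "subframe \<tau>" using assms by (simp add: topoframe_def)
  have C: "frame_hom (rc_const r :: real set \<Rightarrow> 'a)" for r
    using real_continuous_const[OF T] by (simp add: real_continuous_def)
  have H: "frame_hom f" if "real_continuous \<tau> f" for f using that by (simp add: real_continuous_def)
  show ?thesis
  proof (rule cringI)
    show "abelian_group (rc_ring \<tau>)"
    proof (rule abelian_groupI)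
      fix f assume "f \<in> carrier (rc_ring \<tau>)"
      then show "\<exists>g\<in>carrier (rc_ring \<tau>). g \<oplus>\<^bsub>rc_ring \<tau>\<^esub> f = \<zero>\<^bsub>rc_ring \<tau>\<^esub>"
        by (intro bexI[of _ "\<lambda>X. f (uminus ` X)"])
          (auto simp: rc_ring_def rc_op_uminus[OF _ T] real_continuous_uminus)
    qed (auto simp: rc_ring_def intro!: real_continuous_rc_op real_continuous_const T rc_op_assoc
        rc_op_commute rc_op_unit H C continuous_intros)
    show "Group.comm_monoid (rc_ring \<tau>)"
      by (rule comm_monoidI) (auto simp: rc_ring_def intro!: real_continuous_rc_op
          real_continuous_const T rc_op_assoc rc_op_commute rc_op_unit H C continuous_intros)
  qed (auto simp: rc_ring_def intro!: rc_op_distrib H)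
qed

lemma a_inv_rc_ring:
  assumes "topoframe \<tau>" "f \<in> carrier (rc_ring \<tau>)"
  shows "\<ominus>\<^bsub>rc_ring \<tau>\<^esub> f = (\<lambda>X. f (uminus ` X))"
proof -
  interpret cring "rc_ring \<tau>" by (rule cring_rc_ring[OF assms(1)])
  have rc: "real_continuous \<tau> f" using assms(2) by (simp add: rc_ring_def)
  show ?thesis
  proof (rule minus_equality)
    show "(\<lambda>X. f (uminus ` X)) \<oplus>\<^bsub>rc_ring \<tau>\<^esub> f = \<zero>\<^bsub>rc_ring \<tau>\<^esub>"
      using rc_op_uminus[OF rc] assms(1) by (simp add: rc_ring_def topoframe_def)
    show "(\<lambda>X. f (uminus ` X)) \<in> carrier (rc_ring \<tau>)"
      using real_continuous_uminus[OF rc] by (simp add: rc_ring_def)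
  qed (rule assms(2))
qed

end

theory Submission
  imports Defs
begin

text \<open>
  A real-continuous function \<open>f\<close> amounts to the partition of \<open>\<top>\<close> into the pairwise disjoint
  elements \<open>f {x}\<close>, so identities between such functions may be checked piece by piece, as
  if \<open>f {x}\<close> were the set of points where \<open>f\<close> takes the value \<open>x\<close>.

  \<^bold>\<open>Self-injective implies P.\<close> The ring is reduced, so \<open>x \<otimes> (a \<otimes> a) \<mapsto> a \<otimes> x\<close> is a well-defined
  homomorphism on the principal ideal of \<open>a \<otimes> a\<close>. If it extends to the whole ring, its value at
  \<open>\<one>\<close> is some \<open>b\<close> with \<open>a = a \<otimes> a \<otimes> b\<close> (\<open>selfinjective_reduced_imp_regular\<close>). Then
  \<open>e = a \<otimes> b\<close> is an idempotent with the same zero element as \<open>a\<close>, and, \<open>e\<close> taking only the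
  values \<open>0\<close> and \<open>1\<close>, its zero element is \<open>e {-1<..<1}\<close>, which lies in \<open>\<tau>\<close>.

  \<^bold>\<open>P implies self-injective.\<close> Let \<open>h\<close> be a homomorphism on the ideal generated by \<open>f\<^sub>0, f\<^sub>1, \<dots>\<close>.
  Since the zero elements lie in \<open>\<tau>\<close>, each \<open>f\<^sub>n\<close> has a real-continuous quasi-inverse \<open>f\<^sub>n\<^sup>*\<close>,
  namely \<open>1/f\<^sub>n\<close> where \<open>f\<^sub>n \<noteq> 0\<close> and \<open>0\<close> elsewhere. An extension must be multiplication by some
  \<open>g\<close> with \<open>g \<otimes> f\<^sub>n = h f\<^sub>n\<close>, which leaves no choice where \<open>f\<^sub>n \<noteq> 0\<close>: there
  \<open>g = f\<^sub>n\<^sup>* \<otimes> h f\<^sub>n\<close>. So \<open>\<top>\<close> is cut into countably many disjoint elements of \<open>\<tau>\<close>, one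
  below the cozero element of each \<open>f\<^sub>n\<close> and one more, \<open>c\<close>, below all the zero elements, and
  these local candidates are glued, with \<open>0\<close> on \<open>c\<close> (\<open>real_continuous_glue\<close>). On the piece that
  belongs to \<open>f\<^sub>n\<close> the resulting \<open>g\<close> is correct for every other generator \<open>f\<^sub>m\<close> as well, because
  \<open>f\<^sub>m \<otimes> h f\<^sub>n = h (f\<^sub>m \<otimes> f\<^sub>n) = f\<^sub>n \<otimes> h f\<^sub>m\<close>; on \<open>c\<close> both \<open>f\<^sub>m\<close> and \<open>h f\<^sub>m\<close> vanish. The main
  difficulty is that \<open>c\<close> must be in \<open>\<tau>\<close>, although it is the complement of a countable join: it
  is the zero element of a function whose values on the other pieces tend to \<open>0\<close>
  (\<open>P_topoframe_countable_partition\<close>).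
\<close>

section \<open>Frames and subframes\<close>

lemma inf_sup_frame: "inf (x::'a::frame) (sup y z) = sup (inf x y) (inf x z)"
  using inf_SUP_frame[of x "\<lambda>u. u" "{y, z}"] by simp

lemma inf_eq_bot_mono:
  fixes u v :: "'a::frame"
  assumes "inf x y = bot" "u \<le> x" "v \<le> y"
  shows "inf u v = bot"
  using inf_mono[OF assms(2,3)] assms(1) by (simp add: bot_unique)

lemma subframe_inf: "subframe \<tau> \<Longrightarrow> x \<in> \<tau> \<Longrightarrow> y \<in> \<tau> \<Longrightarrow> inf x y \<in> \<tau>"
  and subframe_Sup: "subframe \<tau> \<Longrightarrow> S \<subseteq> \<tau> \<Longrightarrow> Sup S \<in> \<tau>"
  and subframe_top: "subframe \<tau> \<Longrightarrow> top \<in> \<tau>"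
  unfolding subframe_def by blast+

lemma subframe_SUP: "subframe \<tau> \<Longrightarrow> (\<And>i. i \<in> A \<Longrightarrow> F i \<in> \<tau>) \<Longrightarrow> (SUP i\<in>A. F i) \<in> \<tau>"
  by (rule subframe_Sup) auto

lemma subframe_sup: "subframe \<tau> \<Longrightarrow> x \<in> \<tau> \<Longrightarrow> y \<in> \<tau> \<Longrightarrow> sup x y \<in> \<tau>"
  using subframe_Sup[of \<tau> "{x, y}"] by simp

lemma subframe_bot: "subframe \<tau> \<Longrightarrow> bot \<in> \<tau>"
  using subframe_Sup[of \<tau> "{}"] by simp

lemma frame_hom_top: "frame_hom (f :: 'b set \<Rightarrow> 'a::frame) \<Longrightarrow> f UNIV = top"
  unfolding frame_hom_def by simp

lemma frame_hom_inf: "frame_hom f \<Longrightarrow> f (inf x y) = inf (f x) (f y)"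
  unfolding frame_hom_def by blast

lemma frame_hom_Sup: "frame_hom f \<Longrightarrow> f (Sup S) = Sup (f ` S)"
  unfolding frame_hom_def by blast

lemma frame_hom_sup:
  assumes "frame_hom f" shows "f (sup x y) = sup (f x) (f y)"
  using frame_hom_Sup[OF assms, of "{x, y}"] by simp

lemma frame_hom_compl:
  assumes "frame_hom (f :: real set \<Rightarrow> 'a::frame)"
  shows "inf (f X) (f (- X)) = bot" "sup (f X) (f (- X)) = top"
  using frame_hom_inf[OF assms, of X "- X"] frame_hom_sup[OF assms, of X "- X"]
    frame_hom_bot[OF assms] frame_hom_top[OF assms] by (simp_all add: Compl_partition)

lemma real_continuous_frame_hom: "real_continuous \<tau> f \<Longrightarrow> frame_hom f"
  by (simp add: real_continuous_def)

lemma real_continuous_interval: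
  "real_continuous \<tau> f \<Longrightarrow> f {x. of_rat p < x \<and> x < of_rat q} \<in> \<tau>"
  by (simp add: real_continuous_def)

lemma real_continuous_open:
  assumes T: "subframe \<tau>" and f: "real_continuous \<tau> f" and U: "open U"
  shows "f U \<in> \<tau>"
proof -
  let ?I = "\<lambda>p q :: rat. {x::real. of_rat p < x \<and> x < of_rat q}"
  let ?S = "{?I p q | p q. ?I p q \<subseteq> U}"
  have "U = Sup ?S"
  proof (intro equalityI subsetI)
    fix x assume "x \<in> U"
    then obtain p q where "of_rat p < x" "x < of_rat q" "?I p q \<subseteq> U"
      using rational_interval[OF U] by metis
    then show "x \<in> Sup ?S" by blast
  qed blast
  then have "f U = Sup (f ` ?S)"
    using frame_hom_Sup[OF real_continuous_frame_hom[OF f]] by metis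
  moreover have "Sup (f ` ?S) \<in> \<tau>"
    using real_continuous_interval[OF f] by (intro subframe_SUP[OF T]) blast
  ultimately show ?thesis by (simp only:)
qed


section \<open>Composition with real functions\<close>

text \<open>
  The hom \<open>X \<mapsto> f (\<phi> -` X)\<close> is the pointfree form of \<open>\<phi> \<circ> f\<close>.
\<close>

lemma frame_hom_vimage:
  fixes \<phi> :: "real \<Rightarrow> real"
  assumes "frame_hom (f :: real set \<Rightarrow> 'a::frame)"
  shows "frame_hom (\<lambda>X. f (\<phi> -` X))"
  unfolding frame_hom_def
proof (intro conjI allI)
  fix S :: "real set set"
  have "\<phi> -` Sup S = Sup ((\<lambda>X. \<phi> -` X) ` S)" by auto
  then show "f (\<phi> -` Sup S) = Sup ((\<lambda>X. f (\<phi> -` X)) ` S)"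
    using frame_hom_Sup[OF assms, of "(\<lambda>X. \<phi> -` X) ` S"] by (simp add: image_image)
qed (use frame_hom_top[OF assms] frame_hom_inf[OF assms] in \<open>simp_all add: vimage_Int\<close>)

text \<open>
  A discontinuity of \<open>\<phi>\<close> at \<open>0\<close> does no harm if the piece where \<open>f\<close> vanishes is itself open:
  the preimage of an open set is then an open set, possibly with \<open>0\<close> adjoined.
\<close>

lemma real_continuous_vimage:
  assumes T: "subframe \<tau>" and f: "real_continuous \<tau> f" and z: "f {0} \<in> \<tau>"
    and \<phi>: "continuous_on (- {0}) \<phi>"
  shows "real_continuous \<tau> (\<lambda>X. f (\<phi> -` X))"
  unfolding real_continuous_def
proof (intro conjI allI)
  note fh = real_continuous_frame_hom[OF f]
  show "frame_hom (\<lambda>X. f (\<phi> -` X))" using fh by (rule frame_hom_vimage)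
  fix p q :: rat
  let ?U = "{real_of_rat p<..<of_rat q}"
  have "open (\<phi> -` ?U \<inter> - {0})"
    using \<phi> by (subst (asm) continuous_on_open_vimage) auto
  then have 1: "f (\<phi> -` ?U \<inter> - {0}) \<in> \<tau>" by (rule real_continuous_open[OF T f])
  have 2: "f (\<phi> -` ?U \<inter> {0}) \<in> \<tau>"
    using z subframe_bot[OF T] frame_hom_bot[OF fh] by (cases "0 \<in> \<phi> -` ?U") auto
  have "\<phi> -` ?U = sup (\<phi> -` ?U \<inter> - {0}) (\<phi> -` ?U \<inter> {0})" by auto
  then have "f (\<phi> -` ?U) = sup (f (\<phi> -` ?U \<inter> - {0})) (f (\<phi> -` ?U \<inter> {0}))"
    using frame_hom_sup[OF fh] by metis
  then have "f (\<phi> -` ?U) \<in> \<tau>" using subframe_sup[OF T 1 2] by simp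
  moreover have "?U = {x. of_rat p < x \<and> x < of_rat q}" by auto
  ultimately show "f (\<phi> -` {x. of_rat p < x \<and> x < of_rat q}) \<in> \<tau>" by simp
qed

text \<open>
  Operations between functions of the same \<open>f\<close> are computed pointwise, since on the piece
  \<open>f {x}\<close> the two arguments take only the values \<open>\<phi> x\<close> and \<open>\<psi> x\<close>.
\<close>

lemma rc_op_vimage:
  assumes "frame_hom (f :: real set \<Rightarrow> 'a::frame)"
  shows "rc_op d (\<lambda>X. f (\<phi> -` X)) (\<lambda>X. f (\<psi> -` X)) = (\<lambda>X. f ((\<lambda>x. d (\<phi> x) (\<psi> x)) -` X))"
proof (rule rc_op_eqI)
  fix x y
  have "inf (f (\<phi> -` {x})) (f (\<psi> -` {y})) = f (inf (\<phi> -` {x}) (\<psi> -` {y}))"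
    by (simp only: frame_hom_inf[OF assms])
  also have "\<dots> \<le> f ((\<lambda>x. d (\<phi> x) (\<psi> x)) -` {d x y})"
    by (rule frame_hom_mono[OF assms]) auto
  finally show "inf (f (\<phi> -` {x})) (f (\<psi> -` {y})) \<le> f ((\<lambda>x. d (\<phi> x) (\<psi> x)) -` {d x y})" .
qed (rule frame_hom_vimage[OF assms])+


section \<open>Local agreement and gluing\<close>

text \<open>
  This is equality on the part \<open>b\<close> of the frame. Comparing meets with \<open>b\<close> makes it an
  equivalence relation, and a congruence for every operation \<open>rc_op d\<close>, so ring identities can be
  computed on one piece of a partition at a time.
\<close>

definition agree_on :: "'a::frame \<Rightarrow> ('x \<Rightarrow> 'a) \<Rightarrow> ('x \<Rightarrow> 'a) \<Rightarrow> bool" where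
  "agree_on b F G \<longleftrightarrow> (\<forall>X. inf b (F X) = inf b (G X))"

lemma agree_on_refl: "agree_on b F F"
  and agree_on_sym: "agree_on b F G \<Longrightarrow> agree_on b G F"
  and agree_on_trans [trans]: "agree_on b F G \<Longrightarrow> agree_on b G H \<Longrightarrow> agree_on b F H"
  by (simp_all add: agree_on_def)

lemma agree_on_mono:
  assumes "agree_on b F G" "c \<le> b" shows "agree_on c F G"
  unfolding agree_on_def
proof
  fix X
  have "c = inf c b" using assms(2) by (simp add: inf.absorb1)
  then show "inf c (F X) = inf c (G X)"
    using assms(1) unfolding agree_on_def by (metis inf_assoc)
qed

lemma agree_on_rc_op:
  assumes "agree_on b F F'" "agree_on b G G'"
  shows "agree_on b (rc_op d F G) (rc_op d F' G')"
  unfolding agree_on_def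
proof
  fix X
  define C where "C Y Z \<longleftrightarrow> {d y z | y z. y \<in> Y \<and> z \<in> Z} \<subseteq> X" for Y Z
  have split: "inf b (rc_op d P Q X) = Sup {inf (inf b (P Y)) (inf b (Q Z)) | Y Z. C Y Z}" for P Q
  proof -
    have distrib: "inf b (inf (P Y) (Q Z)) = inf (inf b (P Y)) (inf b (Q Z))" for Y Z
      by (simp add: inf_assoc inf_left_commute)
    have "{inf b s | s. s \<in> {inf (P Y) (Q Z) | Y Z. C Y Z}} =
        {inf b (inf (P Y) (Q Z)) | Y Z. C Y Z}"
      by blast
    then show ?thesis unfolding rc_op_def inf_Sup_frame C_def[symmetric] distrib by simp
  qed
  show "inf b (rc_op d F G X) = inf b (rc_op d F' G' X)"
    using assms unfolding split agree_on_def by simp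
qed

lemma agree_on_cover_eq:
  fixes a :: "'i \<Rightarrow> 'a::frame"
  assumes "(SUP i. a i) = top" "\<And>i. agree_on (a i) F G"
  shows "F = G"
proof
  fix X
  have split: "H X = (SUP i. inf (a i) (H X))" for H :: "'b \<Rightarrow> 'a"
    using SUP_inf_frame[of a UNIV "H X"] assms(1) by simp
  have "(SUP i. inf (a i) (F X)) = (SUP i. inf (a i) (G X))"
    using assms(2) by (simp add: agree_on_def)
  then show "F X = G X" using split[of F] split[of G] by simp
qed

lemma agree_on_vimage_const:
  assumes f: "frame_hom (f :: real set \<Rightarrow> 'a::frame)" and \<phi>: "\<And>x. x \<in> Y \<Longrightarrow> \<phi> x = r"
  shows "agree_on (f Y) (\<lambda>X. f (\<phi> -` X)) (rc_const r)"
  unfolding agree_on_def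
proof
  fix X
  have "inf Y (\<phi> -` X) = (if r \<in> X then Y else bot)" using \<phi> by auto
  then show "inf (f Y) (f (\<phi> -` X)) = inf (f Y) (rc_const r X)"
    using frame_hom_inf[OF f, of Y "\<phi> -` X"] frame_hom_bot[OF f] by (auto simp: rc_const_def)
qed

text \<open>
  The prescriptions \<open>F i\<close> cannot conflict, because the pieces are disjoint. Openness of the pieces puts the images of intervals under the glued function in \<open>\<tau>\<close>.
\<close>

lemma real_continuous_glue:
  fixes a :: "'i \<Rightarrow> 'a::frame" and F :: "'i \<Rightarrow> real set \<Rightarrow> 'a"
  assumes T: "subframe \<tau>" and a: "\<And>i. a i \<in> \<tau>" and top: "(SUP i. a i) = top"
    and disj: "\<And>i j. i \<noteq> j \<Longrightarrow> inf (a i) (a j) = bot"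
    and F: "\<And>i. real_continuous \<tau> (F i)"
  obtains g where "real_continuous \<tau> g" "\<And>i. agree_on (a i) g (F i)"
proof
  let ?g = "\<lambda>X. SUP i. inf (a i) (F i X)"
  note Fh = real_continuous_frame_hom[OF F]
  show loc: "agree_on (a i) ?g (F i)" for i
    unfolding agree_on_def
  proof
    fix X
    have "inf (a i) (inf (a j) (F j X)) \<le> inf (a i) (F i X)" for j
    proof (cases "i = j")
      case False
      then have "inf (inf (a i) (a j)) (F j X) = bot" by (simp add: disj)
      then show ?thesis by (simp add: inf_assoc)
    qed simp
    moreover have "inf (a i) (F i X) \<le> inf (a i) (?g X)"
      by (intro inf_greatest inf_le1 SUP_upper UNIV_I)
    ultimately show "inf (a i) (?g X) = inf (a i) (F i X)"
      by (intro antisym) (simp_all add: inf_SUP_frame SUP_le_iff)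
  qed
  have cover: "x = y" if "\<And>i. inf (a i) x = inf (a i) y" for x y
    using fun_cong[OF agree_on_cover_eq[OF top, of "\<lambda>_::unit. x" "\<lambda>_. y"]] that
    by (simp add: agree_on_def)
  have "frame_hom ?g"
    unfolding frame_hom_def
  proof (intro conjI allI)
    show "?g UNIV = top" using top by (simp add: frame_hom_top[OF Fh])
    show "?g (inf X Y) = inf (?g X) (?g Y)" for X Y
    proof (rule cover)
      fix i
      have "inf (a i) (inf (?g X) (?g Y)) = inf (inf (a i) (?g X)) (inf (a i) (?g Y))"
        by (simp add: inf_assoc inf_left_commute)
      also have "\<dots> = inf (inf (a i) (F i X)) (inf (a i) (F i Y))"
        using loc unfolding agree_on_def by metis
      also have "\<dots> = inf (a i) (F i (inf X Y))"
        unfolding frame_hom_inf[OF Fh] by (simp add: inf_assoc inf_left_commute)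
      finally show "inf (a i) (?g (inf X Y)) = inf (a i) (inf (?g X) (?g Y))"
        using loc unfolding agree_on_def by metis
    qed
    show "?g (Sup S) = Sup (?g ` S)" for S
      unfolding frame_hom_Sup[OF Fh] inf_SUP_frame by (rule SUP_commute)
  qed
  then show "real_continuous \<tau> ?g"
    unfolding real_continuous_def
    by (intro conjI allI subframe_SUP[OF T] subframe_inf[OF T] a real_continuous_interval[OF F])
qed


section \<open>Countable partitions in P-topoframes\<close>

text \<open>
  Disjointify the \<open>v n\<close>; the remainder \<open>c\<close> is a complement of a countable join and need not be
  open in a general topoframe. The function that equals \<open>1/(n+1)\<close> on the \<open>n\<close>-th piece and \<open>0\<close>
  on \<open>c\<close> is real-continuous, since a neighbourhood of \<open>0\<close> contains all but finitely many of
  these values and so pulls back to one of the finite meets \<open>D N\<close> of the \<open>w n\<close>. Its zero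
  element is \<open>c\<close>.
\<close>

lemma P_topoframe_countable_partition:
  fixes v w :: "nat \<Rightarrow> 'a::frame"
  assumes P: "P_topoframe \<tau>" and v: "\<And>n. v n \<in> \<tau>" and w: "\<And>n. w n \<in> \<tau>"
    and vw: "\<And>n. inf (v n) (w n) = bot" "\<And>n. sup (v n) (w n) = top"
  obtains a where "\<And>n. a n \<in> \<tau>" "(SUP n. a n) = top"
    "\<And>m n. m \<noteq> n \<Longrightarrow> inf (a m) (a n) = bot" "\<And>n. a (Suc n) \<le> v n" "\<And>n. a 0 \<le> w n"
proof -
  have T: "subframe \<tau>" using P by (simp add: P_topoframe_def topoframe_def)
  define D where "D = rec_nat top (\<lambda>n d. inf d (w n))"
  have D_0: "D 0 = top" and D_Suc: "D (Suc n) = inf (D n) (w n)" for n by (simp_all add: D_def)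
  define B where "B n = inf (D n) (v n)" for n
  have D_in: "D n \<in> \<tau>" for n by (induction n) (simp_all add: D_0 D_Suc subframe_top T subframe_inf w)
  have B_in: "B n \<in> \<tau>" for n unfolding B_def using D_in v T by (intro subframe_inf) auto
  have D_anti: "D n \<le> D m" if "m \<le> n" for m n
    using that by (induction rule: dec_induct) (auto simp: D_Suc intro: le_infI1)
  have D_w: "D n \<le> w m" if "m < n" for m n
    using D_anti[of "Suc m" n] that by (simp add: D_Suc Suc_le_eq)
  have B_v: "B n \<le> v n" and B_D: "B n \<le> D n" for n by (simp_all add: B_def)
  have BD: "inf (B m) (D n) = bot" if "m < n" for m n
    using inf_eq_bot_mono[OF vw(1) B_v D_w[OF that]] .
  have BB: "inf (B m) (B n) = bot" if "m \<noteq> n" for m n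
    using inf_eq_bot_mono[OF BD order_refl B_D] that by (metis inf.commute nat_neq_iff)
  have "(SUP n. B n) \<in> \<tau>" by (intro subframe_SUP[OF T] B_in)
  then obtain c where c: "inf (SUP n. B n) c = bot" "sup (SUP n. B n) c = top"
    using P unfolding P_topoframe_def topoframe_def complemented_def by blast
  have Bc: "inf (B n) c = bot" for n
    using inf_eq_bot_mono[OF c(1) SUP_upper order_refl] by blast
  have cD: "c \<le> D n" for n
  proof (induction n)
    case (Suc n)
    have "c = inf c (inf (D n) (sup (v n) (w n)))"
      using Suc vw(2) by (simp add: inf.absorb1)
    also have "\<dots> = sup (inf c (B n)) (inf c (D (Suc n)))"
      by (simp add: inf_sup_frame B_def D_Suc)
    also have "\<dots> = inf c (D (Suc n))" using Bc[of n] by (simp add: inf.commute)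
    finally show ?case by (simp add: inf.orderI)
  qed (simp add: D_0)
  define a where "a n = (case n of 0 \<Rightarrow> c | Suc m \<Rightarrow> B m)" for n
  have a_0: "a 0 = c" and a_Suc: "a (Suc n) = B n" for n by (simp_all add: a_def)
  have a_top: "(SUP n. a n) = top"
  proof -
    have "sup (SUP n. B n) c \<le> (SUP n. a n)"
      by (intro sup_least SUP_least)
        (metis SUP_upper UNIV_I a_Suc, metis SUP_upper UNIV_I a_0)
    then show ?thesis using c(2) by (simp add: top_unique)
  qed
  have a_disj: "inf (a m) (a n) = bot" if "m \<noteq> n" for m n
    using that Bc BB by (cases m; cases n)
      (auto simp: a_0 a_Suc inf.commute)
  \<comment> \<open>Here \<open>inverse 0 = 0\<close> gives the remainder \<open>a 0 = c\<close> the value \<open>0\<close>.\<close>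
  define u where "u X = (SUP n\<in>{n. inverse (real n) \<in> X}. a n)" for X
  have uh: "frame_hom u"
    unfolding u_def[abs_def] using a_top a_disj by (rule partition_frame_hom)
  have "u {x. of_rat p < x \<and> x < of_rat q} \<in> \<tau>" for p q
  proof (cases "(0::real) \<in> {x. of_rat p < x \<and> x < of_rat q}")
    case False
    have "a n \<in> \<tau>" if "inverse (real n) \<in> {x. of_rat p < x \<and> x < of_rat q}" for n
      using that False B_in by (cases n) (simp_all add: a_Suc)
    then show ?thesis unfolding u_def by (intro subframe_SUP[OF T]) simp
  next
    case True
    let ?I = "{x::real. of_rat p < x \<and> x < of_rat q}"
    define N where "N = (LEAST n. inverse (real (Suc n)) < of_rat q)"
    have N: "inverse (real (Suc N)) < of_rat q"
      unfolding N_def using True by (intro LeastI_ex[OF reals_Archimedean]) simp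
    have large: "inverse (real (Suc n)) \<in> ?I \<longleftrightarrow> N \<le> n" for n
    proof
      assume "inverse (real (Suc n)) \<in> ?I"
      then show "N \<le> n" unfolding N_def by (simp add: Least_le)
    next
      assume "N \<le> n"
      then have "inverse (real (Suc n)) \<le> inverse (real (Suc N))"
        by (intro le_imp_inverse_le) auto
      moreover have "0 < inverse (real (Suc n))" by simp
      moreover have "real_of_rat p < 0" using True by simp
      ultimately have "of_rat p < inverse (real (Suc n))" "inverse (real (Suc n)) < of_rat q"
        using N by linarith+
      then show "inverse (real (Suc n)) \<in> ?I" by simp
    qed
    have "u ?I = D N"
    proof (rule antisym)
      show "u ?I \<le> D N"
        unfolding u_def
      proof (rule SUP_least)
        fix n assume n: "n \<in> {n. inverse (real n) \<in> ?I}"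
        show "a n \<le> D N"
        proof (cases n)
          case 0 then show ?thesis using cD by (simp add: a_0)
        next
          case (Suc m)
          then have "N \<le> m" using n large by blast
          then show ?thesis using B_D D_anti Suc a_Suc order_trans by metis
        qed
      qed
      have "inf (D N) (a n) \<le> u ?I" for n
      proof (cases "inverse (real n) \<in> ?I")
        case True
        then have "a n \<le> u ?I" unfolding u_def by (intro SUP_upper) simp
        then show ?thesis by (rule le_infI2)
      next
        case False
        then have "n \<noteq> 0" using \<open>0 \<in> ?I\<close> by (intro notI) simp
        then obtain m where "n = Suc m" using not0_implies_Suc by blast
        moreover have "m < N" using False large[of m] unfolding \<open>n = Suc m\<close> by linarith
        ultimately show ?thesis using BD[of m N] by (simp add: a_Suc inf.commute)
      qed
      then have "(SUP n. inf (D N) (a n)) \<le> u ?I" by (rule SUP_least)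
      then show "D N \<le> u ?I" using a_top inf_SUP_frame[of "D N" a UNIV] by simp
    qed
    then show ?thesis using D_in by simp
  qed
  then have "real_continuous \<tau> u" using uh by (simp add: real_continuous_def)
  then have "u {0} \<in> \<tau>" using P by (simp add: P_topoframe_def zero_elem_def)
  moreover have "u {0} = c" by (simp add: u_def a_0)
  ultimately have "a n \<in> \<tau>" for n using B_in by (cases n) (simp_all add: a_0 a_Suc)
  moreover have "a (Suc n) \<le> v n" "a 0 \<le> w n" for n
    using B_v D_w[of n "Suc n"] cD[of "Suc n"] by (auto simp: a_Suc a_0 intro: order_trans)
  ultimately show thesis using that a_top a_disj by blast
qed


section \<open>P-topoframes have self-injective rings\<close>

text \<open>
  With \<open>inverse 0 = 0\<close>, composing \<open>f\<close> with \<open>inverse\<close> yields \<open>1/f\<close> on the cozero element of \<open>f\<close>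
  and \<open>0\<close> on its zero element.
\<close>

definition quasi_inverse :: "(real set \<Rightarrow> 'a) \<Rightarrow> real set \<Rightarrow> 'a" where
  "quasi_inverse f X = f (inverse -` X)"

lemma real_continuous_quasi_inverse:
  assumes P: "P_topoframe \<tau>" and f: "real_continuous \<tau> f"
  shows "real_continuous \<tau> (quasi_inverse f)"
proof -
  have "f {0} \<in> \<tau>" using P f by (simp add: P_topoframe_def zero_elem_def)
  then have "real_continuous \<tau> (\<lambda>X. f (inverse -` X))"
    using P f by (intro real_continuous_vimage)
      (auto simp: P_topoframe_def topoframe_def intro!: continuous_intros)
  then show ?thesis by (simp add: quasi_inverse_def[abs_def])
qed

lemma rc_op_quasi_inverse:
  assumes "frame_hom (f :: real set \<Rightarrow> 'a::frame)"
  shows "rc_op (*) (quasi_inverse f) f = (\<lambda>X. f ((\<lambda>x. inverse x * x) -` X))"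
  using rc_op_vimage[OF assms, of "(*)" inverse "\<lambda>x. x"] by (simp add: quasi_inverse_def[abs_def])

text \<open>
  The product of \<open>f\<close> with its quasi-inverse is the indicator of the cozero element of \<open>f\<close>; the
  last part is von Neumann regularity, whenever the quasi-inverse belongs to the ring.
\<close>

lemma mult_quasi_inverse:
  assumes "frame_hom (f :: real set \<Rightarrow> 'a::frame)"
  shows "agree_on (f (- {0})) (rc_op (*) (quasi_inverse f) f) (rc_const 1)"
    "agree_on (f {0}) (rc_op (*) (quasi_inverse f) f) (rc_const 0)"
    "rc_op (*) (rc_op (*) (quasi_inverse f) f) f = f"
proof -
  show "agree_on (f (- {0})) (rc_op (*) (quasi_inverse f) f) (rc_const 1)"
    "agree_on (f {0}) (rc_op (*) (quasi_inverse f) f) (rc_const 0)"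
    unfolding rc_op_quasi_inverse[OF assms]
    by (rule agree_on_vimage_const[OF assms], simp)+
  have "(\<lambda>x::real. inverse x * x * x) = (\<lambda>x. x)"
  proof
    show "inverse x * x * x = x" for x :: real by (cases "x = 0") simp_all
  qed
  then show "rc_op (*) (rc_op (*) (quasi_inverse f) f) f = f"
    unfolding rc_op_quasi_inverse[OF assms]
    using rc_op_vimage[OF assms, of "(*)" "\<lambda>x. inverse x * x" "\<lambda>x. x"] by simp
qed

text \<open>
  A homomorphism defined on the whole ring is multiplication by an element \<open>g\<close>, and the elements
  on which this agrees with \<open>h\<close> form an ideal. Extending \<open>h\<close> is thus a matter of solving
  \<open>g \<otimes> x = h x\<close> for the generators only.
\<close>

lemma (in cring) ideal_hom_eq_mult_on_genideal:
  assumes S: "S \<subseteq> carrier R" and h: "h \<in> ideal_hom R (Idl S)" and g: "g \<in> carrier R"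
    and eq: "\<And>x. x \<in> S \<Longrightarrow> g \<otimes> x = h x" and x: "x \<in> Idl S"
  shows "g \<otimes> x = h x"
proof -
  interpret I: ideal "Idl S" R by (rule genideal_ideal[OF S])
  have IR: "y \<in> carrier R" if "y \<in> Idl S" for y using that I.Icarr by blast
  have hR: "h y \<in> carrier R" if "y \<in> Idl S" for y
    using h that unfolding ideal_hom_def by blast
  have hadd: "h (y \<oplus> z) = h y \<oplus> h z" if "y \<in> Idl S" "z \<in> Idl S" for y z
    using h that unfolding ideal_hom_def by blast
  have hmult: "h (a \<otimes> y) = a \<otimes> h y" if "a \<in> carrier R" "y \<in> Idl S" for a y
    using h that unfolding ideal_hom_def by blast
  let ?J = "{y \<in> Idl S. g \<otimes> y = h y}"
  have mult: "a \<otimes> y \<in> ?J" if a: "a \<in> carrier R" and y: "y \<in> ?J" for a y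
  proof -
    have "g \<otimes> (a \<otimes> y) = a \<otimes> (g \<otimes> y)" using a y IR g by (simp add: m_lcomm)
    then show ?thesis using a y hmult I.I_l_closed by auto
  qed
  have "ideal ?J R"
  proof (rule idealI)
    show "subgroup ?J (add_monoid R)"
    proof (rule add.subgroupI)
      show "?J \<subseteq> carrier R" using IR by blast
      have "\<zero> \<otimes> \<zero> \<in> Idl S" "h (\<zero> \<otimes> \<zero>) = \<zero> \<otimes> h \<zero>" using hmult[of \<zero> \<zero>] by simp_all
      then have "\<zero> \<in> ?J" using hR[of \<zero>] g by simp
      then show "?J \<noteq> {}" by blast
      fix y assume y: "y \<in> ?J"
      have "\<ominus> y = (\<ominus> \<one>) \<otimes> y" using IR y by (simp add: l_minus)
      then show "\<ominus> y \<in> ?J" using mult[OF _ y, of "\<ominus> \<one>"] by simp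
      fix z assume z: "z \<in> ?J"
      show "y \<oplus> z \<in> ?J"
        using y z IR g hadd I.a_closed by (simp add: r_distr)
    qed
    show "y \<otimes> a \<in> ?J" if "y \<in> ?J" "a \<in> carrier R" for y a
      using mult[OF that(2,1)] that IR m_comm by auto
  qed (use mult in \<open>auto intro: ring_axioms\<close>)
  moreover have "S \<subseteq> ?J" using eq genideal_self[OF S] by blast
  ultimately have "Idl S \<subseteq> ?J" by (rule genideal_minimal)
  then show ?thesis using x by blast
qed

lemma P_topoframe_imp_selfinjective:
  assumes P: "P_topoframe \<tau>"
  shows "aleph0_selfinjective (rc_ring \<tau>)"
proof -
  let ?R = "rc_ring \<tau>"
  have topo: "topoframe \<tau>" and T: "subframe \<tau>"
    using P by (simp_all add: P_topoframe_def topoframe_def)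
  interpret R: cring ?R by (rule cring_rc_ring[OF topo])
  have carr: "f \<in> carrier ?R \<longleftrightarrow> real_continuous \<tau> f" for f by (simp add: rc_ring_def)
  have mult: "f \<otimes>\<^bsub>?R\<^esub> g = rc_op (*) f g" for f g by (simp add: rc_ring_def)
  have one: "\<one>\<^bsub>?R\<^esub> = rc_const 1" and zero: "\<zero>\<^bsub>?R\<^esub> = rc_const 0" by (simp_all add: rc_ring_def)
  have cong: "agree_on b (f \<otimes>\<^bsub>?R\<^esub> g) (f' \<otimes>\<^bsub>?R\<^esub> g')"
    if "agree_on b f f'" "agree_on b g g'" for b f f' g g'
    unfolding mult using that by (rule agree_on_rc_op)
  show ?thesis
    unfolding aleph0_selfinjective_def
  proof (intro conjI allI impI ballI)
    show "cring ?R" by (rule R.cring_axioms)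
    fix I h assume "countably_generated_ideal ?R I" and hom: "h \<in> ideal_hom ?R I"
    then obtain S where S: "countable S" "S \<subseteq> carrier ?R" and I: "I = Idl\<^bsub>?R\<^esub> S"
      unfolding countably_generated_ideal_def by blast
    interpret I: ideal I ?R unfolding I by (rule R.genideal_ideal[OF S(2)])
    \<comment> \<open>Adjoining \<open>\<zero>\<close> makes the generating set nonempty, so that a sequence enumerates it.\<close>
    define f where "f = from_nat_into (insert \<zero>\<^bsub>?R\<^esub> S)"
    have range: "range f = insert \<zero>\<^bsub>?R\<^esub> S"
      unfolding f_def using S(1) by (intro range_from_nat_into) auto
    have fI: "f n \<in> I" for n
    proof -
      have "f n \<in> insert \<zero>\<^bsub>?R\<^esub> S" using range by blast
      then show ?thesis using R.genideal_self[OF S(2)] I.zero_closed unfolding I by auto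
    qed
    have fR: "f n \<in> carrier ?R" for n using fI I.Icarr by blast
    have fc: "real_continuous \<tau> (f n)" for n using fR carr by blast
    note fh = real_continuous_frame_hom[OF fc]
    have hR: "h (f n) \<in> carrier ?R" for n using hom fI unfolding ideal_hom_def by blast
    have hm: "h (r \<otimes>\<^bsub>?R\<^esub> f n) = r \<otimes>\<^bsub>?R\<^esub> h (f n)" if "r \<in> carrier ?R" for r n
      using hom fI that unfolding ideal_hom_def by blast
    define q where "q n = quasi_inverse (f n)" for n
    have qR: "q n \<in> carrier ?R" for n
      unfolding q_def carr by (rule real_continuous_quasi_inverse[OF P fc])
    have q_coz: "agree_on (f n (- {0})) (q n \<otimes>\<^bsub>?R\<^esub> f n) \<one>\<^bsub>?R\<^esub>"
      and q_zero: "agree_on (f n {0}) (q n \<otimes>\<^bsub>?R\<^esub> f n) \<zero>\<^bsub>?R\<^esub>"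
      and q_eq: "(q n \<otimes>\<^bsub>?R\<^esub> f n) \<otimes>\<^bsub>?R\<^esub> f n = f n" for n
      unfolding mult one zero q_def using mult_quasi_inverse[OF fh] by blast+
    have coz: "f n (- {0}) \<in> \<tau>" for n using real_continuous_open[OF T fc] by blast
    have zer: "f n {0} \<in> \<tau>" for n using P fc by (simp add: P_topoframe_def zero_elem_def)
    have compl: "inf (f n (- {0})) (f n {0}) = bot" "sup (f n (- {0})) (f n {0}) = top" for n
      using frame_hom_compl[OF fh, of n "- {0}"] by simp_all
    obtain a where a: "\<And>n. a n \<in> \<tau>" "(SUP n. a n) = top"
      "\<And>m n. m \<noteq> n \<Longrightarrow> inf (a m) (a n) = bot"
      "\<And>n. a (Suc n) \<le> f n (- {0})" "\<And>n. a 0 \<le> f n {0}"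
      using P_topoframe_countable_partition[of \<tau> "\<lambda>n. f n (- {0})" "\<lambda>n. f n {0}", OF P coz zer compl]
      by blast
    define F where "F n = (case n of 0 \<Rightarrow> \<zero>\<^bsub>?R\<^esub> | Suc m \<Rightarrow> q m \<otimes>\<^bsub>?R\<^esub> h (f m))" for n
    have "real_continuous \<tau> (F n)" for n
      unfolding F_def carr[symmetric] using qR hR by (cases n) auto
    then obtain g where g: "real_continuous \<tau> g" and gF: "\<And>n. agree_on (a n) g (F n)"
      using real_continuous_glue[OF T a(1-3)] by blast
    have gR: "g \<in> carrier ?R" using g carr by blast
    have gen: "g \<otimes>\<^bsub>?R\<^esub> f m = h (f m)" for m
    proof (rule agree_on_cover_eq[OF a(2)])
      fix n
      show "agree_on (a n) (g \<otimes>\<^bsub>?R\<^esub> f m) (h (f m))"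
      proof (cases n)
        case 0
        \<comment> \<open>Where \<open>f m\<close> vanishes so does \<open>h (f m)\<close>, because \<open>f m\<close> is a multiple of itself by
          \<open>q m \<otimes> f m\<close>, which vanishes there too.\<close>
        have "agree_on (a n) (q m \<otimes>\<^bsub>?R\<^esub> f m) \<zero>\<^bsub>?R\<^esub>"
          using agree_on_mono[OF q_zero a(5)] 0 by simp
        then have "agree_on (a n) ((q m \<otimes>\<^bsub>?R\<^esub> f m) \<otimes>\<^bsub>?R\<^esub> h (f m)) (\<zero>\<^bsub>?R\<^esub> \<otimes>\<^bsub>?R\<^esub> h (f m))"
          by (intro cong agree_on_refl)
        moreover have "(q m \<otimes>\<^bsub>?R\<^esub> f m) \<otimes>\<^bsub>?R\<^esub> h (f m) = h (f m)"
          using hm[of "q m \<otimes>\<^bsub>?R\<^esub> f m" m] q_eq qR fR by simp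
        ultimately have "agree_on (a n) (h (f m)) \<zero>\<^bsub>?R\<^esub>" using hR by simp
        moreover have "agree_on (a n) (g \<otimes>\<^bsub>?R\<^esub> f m) (\<zero>\<^bsub>?R\<^esub> \<otimes>\<^bsub>?R\<^esub> f m)"
          using gF[of n] 0 by (intro cong agree_on_refl) (simp add: F_def)
        ultimately show ?thesis
          using fR by (auto intro: agree_on_trans agree_on_sym)
      next
        case (Suc k)
        have "agree_on (a n) (g \<otimes>\<^bsub>?R\<^esub> f m) ((q k \<otimes>\<^bsub>?R\<^esub> h (f k)) \<otimes>\<^bsub>?R\<^esub> f m)"
          using gF[of n] Suc by (intro cong agree_on_refl) (simp add: F_def)
        also have "(q k \<otimes>\<^bsub>?R\<^esub> h (f k)) \<otimes>\<^bsub>?R\<^esub> f m = q k \<otimes>\<^bsub>?R\<^esub> (f m \<otimes>\<^bsub>?R\<^esub> h (f k))"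
          using qR hR fR by (simp add: R.m_ac)
        also have "f m \<otimes>\<^bsub>?R\<^esub> h (f k) = f k \<otimes>\<^bsub>?R\<^esub> h (f m)"
          using hm[OF fR, of m k] hm[OF fR, of k m] fR R.m_comm by metis
        also have "q k \<otimes>\<^bsub>?R\<^esub> (f k \<otimes>\<^bsub>?R\<^esub> h (f m)) = (q k \<otimes>\<^bsub>?R\<^esub> f k) \<otimes>\<^bsub>?R\<^esub> h (f m)"
          using qR hR fR by (simp add: R.m_assoc)
        also have "agree_on (a n) \<dots> (\<one>\<^bsub>?R\<^esub> \<otimes>\<^bsub>?R\<^esub> h (f m))"
          using agree_on_mono[OF q_coz a(4)] Suc by (intro cong agree_on_refl) simp
        finally show ?thesis using hR by simp
      qed
    qed
    show "\<exists>k\<in>ideal_hom ?R (carrier ?R). \<forall>x\<in>I. k x = h x"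
    proof (intro bexI ballI)
      show "(\<lambda>x. g \<otimes>\<^bsub>?R\<^esub> x) \<in> ideal_hom ?R (carrier ?R)"
        unfolding ideal_hom_def using gR by (auto simp: R.r_distr R.m_lcomm)
      fix x assume x: "x \<in> I"
      show "g \<otimes>\<^bsub>?R\<^esub> x = h x"
      proof (rule R.ideal_hom_eq_mult_on_genideal[OF S(2) _ gR])
        show "h \<in> ideal_hom ?R (Idl\<^bsub>?R\<^esub> S)" "x \<in> Idl\<^bsub>?R\<^esub> S" using hom x unfolding I .
        show "g \<otimes>\<^bsub>?R\<^esub> y = h y" if "y \<in> S" for y
        proof -
          have "y \<in> range f" using that unfolding range by blast
          then show ?thesis using gen by blast
        qed
      qed
    qed
  qed
qed


section \<open>Self-injective rings come from P-topoframes\<close>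

text \<open>
  Division by \<open>a\<close> on the ideal of \<open>a \<otimes> a\<close> is the map to extend; it sends \<open>x \<otimes> (a \<otimes> a)\<close> to
  \<open>a \<otimes> x\<close>. It is well defined because \<open>a \<otimes> d\<close> squares to zero whenever \<open>d \<otimes> (a \<otimes> a) = \<zero>\<close>.
\<close>

lemma (in cring) selfinjective_reduced_imp_regular:
  assumes inj: "aleph0_selfinjective R"
    and red: "\<And>x. x \<in> carrier R \<Longrightarrow> x \<otimes> x = \<zero> \<Longrightarrow> x = \<zero>"
    and a: "a \<in> carrier R"
  obtains b where "b \<in> carrier R" "a = (a \<otimes> a) \<otimes> b"
proof -
  let ?s = "a \<otimes> a"
  have wd: "a \<otimes> x = a \<otimes> y" if x: "x \<in> carrier R" and y: "y \<in> carrier R" and eq: "x \<otimes> ?s = y \<otimes> ?s" for x y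
  proof -
    define d where "d = x \<ominus> y"
    have d: "d \<in> carrier R" using x y by (simp add: d_def)
    have "d \<otimes> ?s = \<zero>"
      using x y a eq by (simp add: d_def minus_eq l_distr l_minus r_neg)
    then have "(a \<otimes> d) \<otimes> (a \<otimes> d) = \<zero>"
      using a d by (simp add: m_ac) (simp add: m_assoc[symmetric])
    then have "a \<otimes> d = \<zero>" using red[of "a \<otimes> d"] a d by simp
    then have "a \<otimes> x \<ominus> a \<otimes> y = \<zero>"
      using a x y by (simp add: d_def minus_eq r_distr r_minus)
    then show ?thesis
      using minus_equality[of "a \<otimes> x" "\<ominus> (a \<otimes> y)"] a x y by (simp add: minus_eq)
  qed
  define h where "h y = a \<otimes> (SOME x. x \<in> carrier R \<and> x \<otimes> ?s = y)" for y
  have h: "h (x \<otimes> ?s) = a \<otimes> x" if x: "x \<in> carrier R" for x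
  proof -
    have "(SOME x'. x' \<in> carrier R \<and> x' \<otimes> ?s = x \<otimes> ?s) \<in> carrier R \<and>
        (SOME x'. x' \<in> carrier R \<and> x' \<otimes> ?s = x \<otimes> ?s) \<otimes> ?s = x \<otimes> ?s"
      by (rule someI[of _ x]) (use x in simp)
    then show ?thesis unfolding h_def using wd[OF _ x] by blast
  qed
  have I: "Idl {?s} = {x \<otimes> ?s | x. x \<in> carrier R}"
    using cgenideal_eq_genideal[of ?s] a by (simp add: cgenideal_def)
  have "h \<in> ideal_hom R (Idl {?s})"
  proof -
    have "h (x \<otimes> ?s \<oplus> y \<otimes> ?s) = h (x \<otimes> ?s) \<oplus> h (y \<otimes> ?s)"
      if "x \<in> carrier R" "y \<in> carrier R" for x y
      using h[of "x \<oplus> y"] h that a by (simp add: l_distr r_distr)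
    moreover have "h (r \<otimes> (x \<otimes> ?s)) = r \<otimes> h (x \<otimes> ?s)"
      if "r \<in> carrier R" "x \<in> carrier R" for r x
    proof -
      have "r \<otimes> (x \<otimes> ?s) = (r \<otimes> x) \<otimes> ?s" using that a by (simp add: m_assoc)
      then show ?thesis
        unfolding h[OF that(2)] using h[OF m_closed[OF that]] that a by (simp add: m_lcomm)
    qed
    ultimately show ?thesis
      unfolding ideal_hom_def I using h a by auto
  qed
  moreover have "countably_generated_ideal R (Idl {?s})"
    unfolding countably_generated_ideal_def using a by (intro exI[of _ "{?s}"]) simp
  ultimately obtain k where k: "k \<in> ideal_hom R (carrier R)" "\<forall>x\<in>Idl {?s}. k x = h x"
    using inj unfolding aleph0_selfinjective_def by blast
  have "a = h ?s" using h[of \<one>] a by simp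
  also have "\<dots> = k ?s" using k(2) genideal_self'[of ?s] a by simp
  also have "\<dots> = k (?s \<otimes> \<one>)" using a by simp
  also have "\<dots> = ?s \<otimes> k \<one>" using k(1) a unfolding ideal_hom_def by blast
  finally have "a = ?s \<otimes> k \<one>" .
  moreover have "k \<one> \<in> carrier R" using k(1) unfolding ideal_hom_def by blast
  ultimately show thesis using that by blast
qed

lemma rc_ring_reduced:
  assumes "subframe \<tau>" "real_continuous \<tau> f" "rc_op (*) f f = rc_const 0"
  shows "f = rc_const 0"
proof (rule frame_hom_eqI)
  show "frame_hom f" "frame_hom (rc_const 0 :: real set \<Rightarrow> 'a)"
    using assms real_continuous_const by (auto intro: real_continuous_frame_hom)
  show "f {x} \<le> rc_const 0 {x}" for x
  proof (cases "x = 0")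
    case False
    have "f {x} \<le> rc_op (*) f f {x * x}" by (rule rc_op_upper) auto
    then show ?thesis using False unfolding assms(3) by (simp add: rc_const_def)
  qed (simp add: rc_const_def)
qed

lemma zero_elem_mult:
  assumes "frame_hom g"
  shows "zero_elem f \<le> zero_elem (rc_op (*) f g)"
proof -
  have "inf (f {0}) (g UNIV) \<le> rc_op (*) f g {0}"
    unfolding rc_op_def by (intro Sup_upper) force
  then show ?thesis by (simp add: zero_elem_def frame_hom_top[OF assms])
qed

text \<open>
  An idempotent takes only the values \<open>0\<close> and \<open>1\<close>, so its zero element is also the part where
  it lies strictly between \<open>-1\<close> and \<open>1\<close>, which is open.
\<close>

lemma zero_elem_idempotent:
  assumes e: "real_continuous \<tau> e" and idem: "rc_op (*) e e = e"
  shows "zero_elem e \<in> \<tau>"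
proof -
  note eh = real_continuous_frame_hom[OF e]
  let ?I = "{x::real. of_rat (-1) < x \<and> x < of_rat 1}"
  have null: "e {x} = bot" if "x * x \<noteq> x" for x
  proof -
    have "e {x} \<le> rc_op (*) e e {x * x}" by (rule rc_op_upper) auto
    then have "e {x} \<le> inf (e {x * x}) (e {x})" unfolding idem by simp
    then show ?thesis using frame_hom_disj[OF eh that] by (simp add: bot_unique)
  qed
  have "e ?I = e {0}"
  proof (rule antisym)
    have "e {x} \<le> e {0}" if "x \<in> ?I" for x
      using that null[of x] by (cases "x = 0") auto
    then show "e ?I \<le> e {0}" unfolding frame_hom_point[OF eh, of ?I] by (rule SUP_least)
    show "e {0} \<le> e ?I" by (rule frame_hom_mono[OF eh]) simp
  qed
  then show ?thesis using real_continuous_interval[OF e, of "-1" 1] by (simp add: zero_elem_def)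
qed

lemma selfinjective_imp_P_topoframe:
  assumes topo: "topoframe \<tau>" and inj: "aleph0_selfinjective (rc_ring \<tau>)"
  shows "P_topoframe \<tau>"
  unfolding P_topoframe_def
proof (intro conjI allI impI topo)
  fix f assume f: "real_continuous \<tau> f"
  let ?R = "rc_ring \<tau>"
  have T: "subframe \<tau>" using topo by (simp add: topoframe_def)
  interpret R: cring ?R by (rule cring_rc_ring[OF topo])
  have carr: "g \<in> carrier ?R \<longleftrightarrow> real_continuous \<tau> g" for g by (simp add: rc_ring_def)
  have mult: "g \<otimes>\<^bsub>?R\<^esub> k = rc_op (*) g k" for g k by (simp add: rc_ring_def)
  have fR: "f \<in> carrier ?R" using f carr by blast
  have "x = \<zero>\<^bsub>?R\<^esub>" if "x \<in> carrier ?R" "x \<otimes>\<^bsub>?R\<^esub> x = \<zero>\<^bsub>?R\<^esub>" for x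
    using rc_ring_reduced[OF T] that by (simp add: rc_ring_def)
  then obtain b where b: "b \<in> carrier ?R" and fb: "f = (f \<otimes>\<^bsub>?R\<^esub> f) \<otimes>\<^bsub>?R\<^esub> b"
    using R.selfinjective_reduced_imp_regular[OF inj _ fR] by blast
  define e where "e = f \<otimes>\<^bsub>?R\<^esub> b"
  have eR: "e \<in> carrier ?R" using fR b by (simp add: e_def)
  have ef: "e \<otimes>\<^bsub>?R\<^esub> f = f"
  proof -
    have "e \<otimes>\<^bsub>?R\<^esub> f = (f \<otimes>\<^bsub>?R\<^esub> f) \<otimes>\<^bsub>?R\<^esub> b"
      unfolding e_def using fR b by (simp add: R.m_ac)
    then show ?thesis using fb by simp
  qed
  have "e \<otimes>\<^bsub>?R\<^esub> e = (e \<otimes>\<^bsub>?R\<^esub> f) \<otimes>\<^bsub>?R\<^esub> b"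
    unfolding e_def using fR b by (simp add: R.m_assoc)
  then have "e \<otimes>\<^bsub>?R\<^esub> e = e" unfolding ef by (simp add: e_def)
  then have "zero_elem e \<in> \<tau>"
    using zero_elem_idempotent[of \<tau> e] eR unfolding mult carr by blast
  \<comment> \<open>Each of \<open>e = f \<otimes> b\<close> and \<open>f = e \<otimes> f\<close> is a multiple of the other.\<close>
  moreover have "zero_elem f = zero_elem e"
  proof (rule antisym)
    show "zero_elem f \<le> zero_elem e"
      unfolding e_def mult using b carr by (intro zero_elem_mult real_continuous_frame_hom) blast
    show "zero_elem e \<le> zero_elem f"
      using zero_elem_mult[OF real_continuous_frame_hom[OF f], of e] ef unfolding mult by simp
  qed
  ultimately show "zero_elem f \<in> \<tau>" by simp
qed

theorem theorem3:
  fixes \<tau> :: "'a::frame set"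
  assumes "topoframe \<tau>"
  shows "P_topoframe \<tau> \<longleftrightarrow> aleph0_selfinjective (rc_ring \<tau>)"
  using P_topoframe_imp_selfinjective selfinjective_imp_P_topoframe[OF assms] by blast

end
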